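(* Let $\{x^k\}$ be the sequence generated by the parameter-dependent generalized conditional gradient algorithm (PGM-CondG) described in the context. Then: (i) $\lim_{k\to\infty}\theta(x^k)=0$; (ii) for all $k\ge0$, $$\min_{0\le j\le k}|\theta(x^j)|\le\max\left\{\frac{(1+\nu)(f_0^{\max}-f^{\inf})}{\nu(k+1)},\ \left(\frac{(1+\nu)M_\nu^{\frac1\nu}D^{\frac{1+\nu}{\nu}}(f_0^{\max}-f^{\inf})}{\nu(k+1)}\right)^{\frac{\nu}{1+\nu}}\right\}.$$
   Context: Let $m,n\ge 1$. For each $i\in\{1,\dots,m\}$ let $g_i:\mathbb{R}^n\to\mathbb{R}\cup\{+\infty\}$ be proper, convex and lower semicontinuous, let $h_i:\mathbb{R}^n\to\mathbb{R}$ be continuously differentiable, and set $f_i=g_i+h_i$, $F=(f_1,\dots,f_m)^\top$, $G=(g_1,\dots,g_m)^\top$, $H=(h_1,\dots,h_m)^\top$. Put $\mathrm{dom}(g_i)=\{x: g_i(x)<+\infty\}$ and $\mathrm{dom}(G)=\bigcap_i\mathrm{dom}(g_i)$; $\mathrm{dom}(G)$ is assumed nonempty, convex and compact, with diameter $D=\sup_{x,y\in\mathrm{dom}(G)}\|x-y\|$ ($\|\cdot\|$ the Euclidean norm). Hölder assumption: there are $\nu\in(0,1]$ and $M_{i,\nu}>0$ with $\|\nabla h_i(x)-\nabla h_i(y)\|\le M_{i,\nu}\|x-y\|^\nu$ for all $x,y\in\mathrm{dom}(g_i)$, $i=1,\dots,m$; set $M_\nu=\max_i M_{i,\nu}$.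 For $x\in\mathrm{dom}(G)$ the gap function is $\theta(x)=\min_{u\in\mathbb{R}^n}\max_{1\le i\le m}\{g_i(u)-g_i(x)+\langle\nabla h_i(x),u-x\rangle\}$ (so $\theta(x)\le0$), and $s(x)\in\mathrm{dom}(G)$ denotes a chosen minimizer. Algorithm PGM-CondG: start from $x^0\in\mathrm{dom}(G)$. At iteration $k=0,1,\dots$ compute $s(x^k)$ and $\theta(x^k)$; stop if $\theta(x^k)=0$; otherwise set $$t_k=\min\left\{1,\left(\frac{|\theta(x^k)|}{M_\nu\|s(x^k)-x^k\|^{1+\nu}}\right)^{1/\nu}\right\},\qquad x^{k+1}=x^k+t_k(s(x^k)-x^k).$$ The generated sequence is understood to be infinite, i.e. $\theta(x^k)\ne0$ for all $k$ (then $s(x^k)\neq x^k$). Finally $f_0^{\max}=\max_{1\le i\le m}f_i(x^0)$ and $f^{\inf}=\min_{1\le i\le m}f_i^*$, where $f_i^*=\inf\{f_i(x):x\in\mathrm{dom}(G)\}$. *)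

theory Defs
  imports "HOL-Analysis.Analysis"
begin

text \<open>
  The objectives are indexed by a finite (hence nonempty) type \<open>'m\<close>, and \<open>\<real>\<^sup>n\<close> is \<open>real ^ 'n\<close>.
  Functions into \<open>\<real> \<union> {+\<infinity>}\<close> are \<^typ>\<open>ereal\<close>-valued; the value \<open>-\<infinity>\<close> is excluded by
  \<open>proper_fun\<close>.
\<close>

definition edom :: "('a \<Rightarrow> ereal) \<Rightarrow> 'a set" where
  "edom g = {x. g x < \<infinity>}"

definition proper_fun :: "('a \<Rightarrow> ereal) \<Rightarrow> bool" where
  "proper_fun g \<longleftrightarrow> (\<forall>x. g x \<noteq> - \<infinity>) \<and> edom g \<noteq> {}"

text \<open>The convention \<open>0 * \<infinity> = 0\<close> of \<^typ>\<open>ereal\<close> makes the endpoint cases trivial.\<close>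

definition convex_fun :: "('a::real_vector \<Rightarrow> ereal) \<Rightarrow> bool" where
  "convex_fun g \<longleftrightarrow>
     (\<forall>x y. \<forall>u\<ge>0. \<forall>v\<ge>0. u + v = 1 \<longrightarrow>
        g (u *\<^sub>R x + v *\<^sub>R y) \<le> ereal u * g x + ereal v * g y)"

definition lsc_fun :: "('a::topological_space \<Rightarrow> ereal) \<Rightarrow> bool" where
  "lsc_fun g \<longleftrightarrow> (\<forall>x. g x \<le> Liminf (at x) g)"

text \<open>Meaningful only where the function is differentiable; the gradient is then unique.\<close>

definition grad :: "('a::real_inner \<Rightarrow> real) \<Rightarrow> 'a \<Rightarrow> 'a" where
  "grad h x = (THE d. GDERIV h x :> d)"

definition C1_fun :: "('a::real_inner \<Rightarrow> real) \<Rightarrow> bool" where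
  "C1_fun h \<longleftrightarrow> (\<forall>x. h differentiable (at x)) \<and> continuous_on UNIV (grad h)"

definition domG :: "('m \<Rightarrow> 'a \<Rightarrow> ereal) \<Rightarrow> 'a set" where
  "domG g = (\<Inter>i. edom (g i))"

text \<open>
  The function of \<open>u\<close> minimised in the definition of the gap function at \<open>x\<close>. For \<open>x\<close> in
  \<open>domG g\<close> the subtracted value \<open>g i x\<close> is finite, so no \<open>\<infinity> - \<infinity>\<close> occurs.
\<close>

definition gap_model ::
  "('m::finite \<Rightarrow> 'a::real_inner \<Rightarrow> ereal) \<Rightarrow> ('m \<Rightarrow> 'a \<Rightarrow> real) \<Rightarrow> 'a \<Rightarrow> 'a \<Rightarrow> ereal" where
  "gap_model g h x u = (MAX i. g i u - g i x + ereal (grad (h i) x \<bullet> (u - x)))"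

definition gap_fun ::
  "('m::finite \<Rightarrow> 'a::real_inner \<Rightarrow> ereal) \<Rightarrow> ('m \<Rightarrow> 'a \<Rightarrow> real) \<Rightarrow> 'a \<Rightarrow> ereal" where
  "gap_fun g h x = (INF u. gap_model g h x u)"

text \<open>
  A choice of minimisers \<open>s\<close>; by \<open>is_arg_min\<close>, the infimum in \<open>gap_fun\<close> is a minimum on
  \<open>domG g\<close>, and it is finite because \<open>s x\<close> lies in \<open>domG g\<close>.
\<close>

definition gap_minimizer ::
  "('m::finite \<Rightarrow> 'a::real_inner \<Rightarrow> ereal) \<Rightarrow> ('m \<Rightarrow> 'a \<Rightarrow> real) \<Rightarrow> ('a \<Rightarrow> 'a) \<Rightarrow> bool" where
  "gap_minimizer g h s \<longleftrightarrow>
     (\<forall>x\<in>domG g. s x \<in> domG g \<and> is_arg_min (gap_model g h x) (\<lambda>_. True) (s x))"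

definition holder_grad ::
  "('m \<Rightarrow> 'a::real_inner \<Rightarrow> ereal) \<Rightarrow> ('m \<Rightarrow> 'a \<Rightarrow> real) \<Rightarrow> real \<Rightarrow> ('m \<Rightarrow> real) \<Rightarrow> bool" where
  "holder_grad g h \<nu> M \<longleftrightarrow>
     (\<forall>i. M i > 0 \<and>
        (\<forall>x\<in>edom (g i). \<forall>y\<in>edom (g i).
           norm (grad (h i) x - grad (h i) y) \<le> M i * norm (x - y) powr \<nu>))"

text \<open>In the following, \<open>L\<close> stands for the constant \<open>M\<^sub>\<nu>\<close>, the largest of the \<open>M i\<close>.\<close>

definition pgm_step ::
  "('m::finite \<Rightarrow> 'a::real_inner \<Rightarrow> ereal) \<Rightarrow> ('m \<Rightarrow> 'a \<Rightarrow> real) \<Rightarrow> real \<Rightarrow> real \<Rightarrow>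
   ('a \<Rightarrow> 'a) \<Rightarrow> 'a \<Rightarrow> real" where
  "pgm_step g h \<nu> L s x =
     min 1 ((real_of_ereal \<bar>gap_fun g h x\<bar> / (L * norm (s x - x) powr (1 + \<nu>))) powr (1 / \<nu>))"

text \<open>Infinite runs only: the stopping test fails at every iterate.\<close>

definition pgm_condg_sequence ::
  "('m::finite \<Rightarrow> 'a::real_inner \<Rightarrow> ereal) \<Rightarrow> ('m \<Rightarrow> 'a \<Rightarrow> real) \<Rightarrow> real \<Rightarrow> real \<Rightarrow>
   ('a \<Rightarrow> 'a) \<Rightarrow> (nat \<Rightarrow> 'a) \<Rightarrow> bool" where
  "pgm_condg_sequence g h \<nu> L s x \<longleftrightarrow>
     x 0 \<in> domG g \<and>
     (\<forall>k. gap_fun g h (x k) \<noteq> 0 \<and>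
          x (Suc k) = x k + pgm_step g h \<nu> L s (x k) *\<^sub>R (s (x k) - x k))"

definition objective ::
  "('m \<Rightarrow> 'a \<Rightarrow> ereal) \<Rightarrow> ('m \<Rightarrow> 'a \<Rightarrow> real) \<Rightarrow> 'm \<Rightarrow> 'a \<Rightarrow> ereal" where
  "objective g h i x = g i x + ereal (h i x)"

text \<open>
  Both of the following are finite under the standing assumptions (\<open>x\<close> in \<open>domG g\<close>; each objective
  is lower semicontinuous and never \<open>-\<infinity>\<close> on the nonempty compact set \<open>domG g\<close>).
\<close>

definition f_max :: "('m::finite \<Rightarrow> 'a \<Rightarrow> ereal) \<Rightarrow> ('m \<Rightarrow> 'a \<Rightarrow> real) \<Rightarrow> 'a \<Rightarrow> ereal" where
  "f_max g h x = (MAX i. objective g h i x)"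

definition f_inf :: "('m::finite \<Rightarrow> 'a \<Rightarrow> ereal) \<Rightarrow> ('m \<Rightarrow> 'a \<Rightarrow> real) \<Rightarrow> ereal" where
  "f_inf g h = (MIN i. INF x\<in>domG g. objective g h i x)"

end

(*
  The Hoelder condition bounds each smooth part by its linearisation plus
  M t^(1+nu) |s - x|^(1+nu) / (1+nu), and the step size keeps that error below
  t |theta| / (1+nu). Hence one iteration lowers every objective by at least
  nu / (1+nu) * a_k with a_k = t_k |theta(x^k)|, so the a_k are summable with sum at most
  C = (1+nu) Delta / nu. The two cases of the step size give
  |theta| <= omega(a) for omega(u) = max u ((M^(1/nu) D^((1+nu)/nu) u)^(nu/(1+nu))),
  which is monotone and continuous with omega(0) = 0. Thus a_k -> 0 gives (i), and
  min_{j <= k} a_j <= C / (k+1) gives (ii).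
*)
theory Submission
  imports Defs
begin

text \<open>The definite description in \<open>grad\<close> is resolved by Riesz representation: the
  derivative \<open>h'\<close> is linear, so \<open>h' v = v \<bullet> adjoint h' 1\<close>, and
  uniqueness of the derivative forces every gradient to equal \<open>adjoint h' 1\<close>.\<close>

lemma GDERIV_grad:
  fixes h :: "'a::euclidean_space \<Rightarrow> real"
  assumes "h differentiable (at x)"
  shows "GDERIV h x :> grad h x"
proof -
  obtain h' where h': "(h has_derivative h') (at x)"
    using assms by (auto simp: differentiable_def)
  have lin: "linear h'"
    using h' has_derivative_linear by blast
  have "h' = (\<lambda>v. v \<bullet> adjoint h' 1)"
    using adjoint_works[OF lin, of _ 1] by auto
  with h' have gd: "GDERIV h x :> adjoint h' 1"
    unfolding gderiv_def by simp
  moreover have "d = adjoint h' 1" if "GDERIV h x :> d" for d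
  proof -
    have "(\<lambda>v. v \<bullet> d) = h'"
      using that h' unfolding gderiv_def by (rule has_derivative_unique)
    then have "\<forall>v. v \<bullet> d = v \<bullet> adjoint h' 1"
      using adjoint_works[OF lin, of _ 1] by (metis inner_real_def mult.right_neutral)
    then show ?thesis
      by (simp add: vector_eq_ldot)
  qed
  ultimately have "grad h x = adjoint h' 1"
    unfolding grad_def by (intro the_equality)
  with gd show ?thesis
    by simp
qed

text \<open>Along the segment from \<open>x\<close> to \<open>y\<close>, the excess of
  \<open>h\<close> over its linearisation and the claimed error is nonincreasing: Cauchy-Schwarz and
  the Hoelder bound make its derivative nonpositive.\<close>

lemma holder_descent:
  fixes h :: "'a::euclidean_space \<Rightarrow> real"
  assumes diff: "\<And>z. h differentiable (at z)"
    and S: "convex S" "x \<in> S" "y \<in> S"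
    and holder: "\<And>z. z \<in> S \<Longrightarrow> norm (grad h z - grad h x) \<le> K * norm (z - x) powr \<nu>"
    and nu: "0 < \<nu>" and t: "0 \<le> t" "t \<le> 1"
  shows "h (x + t *\<^sub>R (y - x)) \<le> h x + t * (grad h x \<bullet> (y - x))
           + K * (t * norm (y - x)) powr (1 + \<nu>) / (1 + \<nu>)"
proof -
  define d where "d = y - x"
  \<comment> \<open>Chosen so that \<open>\<phi> 0 = h x\<close> and
    \<open>\<phi> t \<le> \<phi> 0\<close> is the claim; the error is split into a power of
    \<open>r\<close> times a constant so that differentiating cancels the factor
    \<open>1 + \<nu>\<close>.\<close>
  define \<phi> where "\<phi> r = h (x + r *\<^sub>R d) - r * (grad h x \<bullet> d)
    - K * (r powr (1 + \<nu>) * norm d powr (1 + \<nu>)) / (1 + \<nu>)" for r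
  have deriv_h: "((\<lambda>r. h (x + r *\<^sub>R d)) has_real_derivative (grad h (x + r *\<^sub>R d) \<bullet> d)) (at r)" for r
  proof -
    have "(h has_derivative (\<lambda>v. v \<bullet> grad h (x + r *\<^sub>R d))) (at (x + r *\<^sub>R d))"
      using GDERIV_grad[OF diff] by (simp add: gderiv_def)
    moreover have "((\<lambda>r. x + r *\<^sub>R d) has_derivative (\<lambda>v. v *\<^sub>R d)) (at r)"
      by (auto intro!: derivative_eq_intros)
    ultimately have "((\<lambda>r. h (x + r *\<^sub>R d)) has_derivative
        (\<lambda>v. (v *\<^sub>R d) \<bullet> grad h (x + r *\<^sub>R d))) (at r)"
      by (rule has_derivative_compose[rotated])
    then show ?thesis
      by (simp add: has_field_derivative_def inner_commute mult_commute_abs)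
  qed
  have deriv_\<phi>: "(\<phi> has_real_derivative ((grad h (x + r *\<^sub>R d) - grad h x) \<bullet> d
      - K * (r powr \<nu> * norm d powr (1 + \<nu>)))) (at r)" if "0 < r" for r
    unfolding \<phi>_def using that nu
    by (auto intro!: derivative_eq_intros deriv_h simp: inner_diff_left)
  have "\<phi> t \<le> \<phi> 0"
  \<comment> \<open>The derivative of \<open>\<phi>\<close> is computed only for
    \<open>0 < r\<close>, where \<open>powr\<close> is smooth; the endpoint 0 enters through
    continuity on \<open>{0..t}\<close>.\<close>
  proof (rule DERIV_nonpos_imp_decreasing_open[OF t(1)])
    fix r assume r: "0 < r" "r < t"
    have "x + r *\<^sub>R d = (1 - r) *\<^sub>R x + r *\<^sub>R y"
      by (simp add: d_def algebra_simps)
    then have "x + r *\<^sub>R d \<in> S"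
      using S r t by (simp add: convexD_alt)
    then have "norm (grad h (x + r *\<^sub>R d) - grad h x) \<le> K * (r * norm d) powr \<nu>"
      using holder[of "x + r *\<^sub>R d"] r by simp
    then have "norm (grad h (x + r *\<^sub>R d) - grad h x) * norm d \<le> K * (r * norm d) powr \<nu> * norm d"
      by (simp add: mult_right_mono)
    also have "\<dots> = K * (r powr \<nu> * norm d powr (1 + \<nu>))"
      using r by (simp add: powr_mult powr_add)
    finally have "(grad h (x + r *\<^sub>R d) - grad h x) \<bullet> d \<le> K * (r powr \<nu> * norm d powr (1 + \<nu>))"
      using norm_cauchy_schwarz order_trans by blast
    then show "\<exists>y. (\<phi> has_real_derivative y) (at r) \<and> y \<le> 0"
      using deriv_\<phi>[OF r(1)] by (intro exI conjI) auto
  next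
    have "continuous_on {0..t} (\<lambda>r. h (x + r *\<^sub>R d))"
      using DERIV_isCont[OF deriv_h] by (intro continuous_at_imp_continuous_on) auto
    moreover have "continuous_on {0..t} (\<lambda>r. r powr (1 + \<nu>))"
      using nu by (intro continuous_on_powr' continuous_on_id continuous_on_const) auto
    ultimately show "continuous_on {0..t} \<phi>"
      unfolding \<phi>_def divide_inverse
      by (intro continuous_on_diff continuous_on_mult continuous_on_id continuous_on_const)
  qed
  then show ?thesis
    using t nu by (simp add: \<phi>_def d_def powr_mult)
qed

text \<open>Points of \<open>S\<close> with values below every \<open>- n\<close> would have a
  subsequence converging to some \<open>l\<close> in \<open>S\<close>, whereas lower semicontinuity
  keeps \<open>g\<close> above a real \<open>c < g l\<close> near \<open>l\<close>. The value
  \<open>g l\<close> may be infinite, so a real \<open>c\<close> is inserted below it.\<close>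

lemma lsc_fun_bounded_below:
  fixes g :: "'a::metric_space \<Rightarrow> ereal"
  assumes lsc: "lsc_fun g" and S: "compact S" and fin: "\<And>x. x \<in> S \<Longrightarrow> g x \<noteq> -\<infinity>"
  obtains b where "\<And>x. x \<in> S \<Longrightarrow> ereal b \<le> g x"
proof (rule ccontr)
  assume "\<not> thesis"
  then have "\<exists>y\<in>S. g y < ereal (- real n)" for n
    using that[of "- real n"] not_le by blast
  then obtain y where y: "\<And>n. y n \<in> S" "\<And>n. g (y n) < ereal (- real n)"
    by metis
  obtain l r where l: "l \<in> S" "strict_mono r" "(y \<circ> r) \<longlonglongrightarrow> l"
    using S y(1) unfolding compact_def by metis
  have "-\<infinity> < g l"
    using fin[OF l(1)] by simp
  then obtain c where c: "ereal c < g l"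
    using ereal_dense2 by blast
  have "ereal c < Liminf (at l) g"
    using c lsc by (auto simp: lsc_fun_def intro: less_le_trans)
  \<comment> \<open>\<open>Liminf (at l) g\<close> ignores the point \<open>l\<close> itself;
    \<open>c < g l\<close> covers terms of the sequence that equal \<open>l\<close>.\<close>
  then have "\<forall>\<^sub>F z in nhds l. ereal c < g z"
    using c less_LiminfD[of "ereal c" "at l" g] by (simp add: eventually_nhds_conv_at)
  then have "\<forall>\<^sub>F n in sequentially. ereal c < g (y (r n))"
    using l(3) by (auto simp: filterlim_iff)
  moreover obtain N where N: "- c < real N"
    using reals_Archimedean2 by blast
  ultimately have "\<forall>\<^sub>F n in sequentially. ereal c < g (y (r n)) \<and> N \<le> n"
    using eventually_ge_at_top eventually_conj by blast
  then obtain n where n: "ereal c < g (y (r n))" "N \<le> n"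
    by (metis (mono_tags, lifting) eventually_sequentially order_refl)
  have "N \<le> r n"
    using n(2) seq_suble[OF l(2), of n] by linarith
  then have "ereal (- real (r n)) \<le> ereal c"
    using N by simp
  then show False
    using n(1) y(2)[of "r n"] by (meson less_le_trans not_less_iff_gr_or_eq less_trans)
qed

text \<open>The step size satisfies \<open>t powr \<nu> \<le> q\<close>, with \<open>q\<close> the
  quotient in its definition; multiplying by \<open>t\<close> bounds the Hoelder error. For the last
  bound, either \<open>t = 1\<close> and \<open>\<theta> = t * \<theta>\<close>, or
  \<open>t = q powr (1 / \<nu>)\<close> and this equation is solved for
  \<open>\<theta>\<close>.\<close>

lemma min_step_bounds:
  fixes \<theta> L d \<nu> :: real
  defines "t \<equiv> min 1 ((\<theta> / (L * d powr (1 + \<nu>))) powr (1 / \<nu>))"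
  assumes pos: "0 < \<theta>" "0 < L" "0 < d" "0 < \<nu>" and D: "d \<le> D"
  shows "0 < t" "t \<le> 1"
    and "L * (t * d) powr (1 + \<nu>) \<le> t * \<theta>"
    and "\<theta> \<le> max (t * \<theta>) ((L powr (1 / \<nu>) * D powr ((1 + \<nu>) / \<nu>) * (t * \<theta>)) powr (\<nu> / (1 + \<nu>)))"
proof -
  define q where "q = \<theta> / (L * d powr (1 + \<nu>))"
  have q: "0 < q"
    using pos by (simp add: q_def)
  have t_def': "t = min 1 (q powr (1 / \<nu>))"
    by (simp add: t_def q_def)
  show t: "0 < t" "t \<le> 1"
    using q by (auto simp: t_def')
  have "t powr \<nu> \<le> (q powr (1 / \<nu>)) powr \<nu>"
    using t pos by (intro powr_mono2) (auto simp: t_def')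
  also have "\<dots> = q"
    using pos q by (simp add: powr_powr)
  finally have "t powr \<nu> * (L * d powr (1 + \<nu>)) \<le> \<theta>"
    using pos by (simp add: q_def pos_le_divide_eq)
  then have "t * (t powr \<nu> * (L * d powr (1 + \<nu>))) \<le> t * \<theta>"
    using t by simp
  moreover have "(t * d) powr (1 + \<nu>) = t * t powr \<nu> * d powr (1 + \<nu>)"
    using t pos by (simp add: powr_mult powr_add abs_mult)
  ultimately show "L * (t * d) powr (1 + \<nu>) \<le> t * \<theta>"
    by (simp add: mult_ac)
  show "\<theta> \<le> max (t * \<theta>) ((L powr (1 / \<nu>) * D powr ((1 + \<nu>) / \<nu>) * (t * \<theta>)) powr (\<nu> / (1 + \<nu>)))"
  proof (cases "t = 1")
    case False
    \<comment> \<open>Since \<open>p = 1 + 1 / \<nu>\<close>, the product of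
      \<open>\<theta> powr (1 / \<nu>)\<close> and \<open>\<theta>\<close> is
      \<open>\<theta> powr p\<close>; taking the root \<open>1 / p\<close> then isolates
      \<open>\<theta>\<close>.\<close>
    define p where "p = (1 + \<nu>) / \<nu>"
    have p: "p = 1 + 1 / \<nu>" "\<nu> / (1 + \<nu>) = 1 / p" "0 < p"
      using pos by (auto simp: p_def field_simps)
    have "t = q powr (1 / \<nu>)"
      using False by (auto simp: t_def')
    also have "\<dots> = \<theta> powr (1 / \<nu>) / (L powr (1 / \<nu>) * d powr p)"
      using pos by (simp add: q_def p_def powr_divide powr_mult powr_powr)
    finally have "L powr (1 / \<nu>) * d powr p * (t * \<theta>) = \<theta> powr (1 / \<nu>) * \<theta>"
      using pos by simp
    also have "\<dots> = \<theta> powr p"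
      using pos by (simp add: p(1) powr_add)
    finally have "\<theta> powr p = L powr (1 / \<nu>) * d powr p * (t * \<theta>)" ..
    also have "\<dots> \<le> L powr (1 / \<nu>) * D powr p * (t * \<theta>)"
      using pos t D p by (intro mult_right_mono mult_left_mono powr_mono2) auto
    finally have "(\<theta> powr p) powr (1 / p) \<le> (L powr (1 / \<nu>) * D powr p * (t * \<theta>)) powr (1 / p)"
      using p by (intro powr_mono2) auto
    then have "\<theta> \<le> (L powr (1 / \<nu>) * D powr p * (t * \<theta>)) powr (1 / p)"
      using pos p by (simp add: powr_powr)
    then show ?thesis
      by (simp add: p_def[symmetric] p(2) le_max_iff_disj)
  qed simp
qed

text \<open>Nonnegative terms with bounded partial sums form a convergent series, so
  \<open>a\<close> tends to 0 and continuity of \<open>\<omega>\<close> carries this to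
  \<open>\<theta>\<close>. For the rate, the least of the first \<open>k + 1\<close> terms is at
  most their average, and \<open>\<omega>\<close> is monotone.\<close>

lemma bounded_sums_imp_rate:
  fixes a \<theta> :: "nat \<Rightarrow> real" and \<omega> :: "real \<Rightarrow> real"
  assumes a: "\<And>k. 0 \<le> a k" and sum: "\<And>k. sum a {..k} \<le> C"
    and le: "\<And>k. 0 \<le> \<theta> k" "\<And>k. \<theta> k \<le> \<omega> (a k)"
    and mono: "\<And>u v. 0 \<le> u \<Longrightarrow> u \<le> v \<Longrightarrow> \<omega> u \<le> \<omega> v"
    and cont: "continuous_on {0..} \<omega>" and zero: "\<omega> 0 = 0"
  shows "\<theta> \<longlonglongrightarrow> 0" and "\<exists>j\<le>k. \<theta> j \<le> \<omega> (C / (real k + 1))"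
proof -
  have "sum a {..<n} \<le> C" for n
    using sum[of n] a by (simp add: lessThan_Suc_atMost[symmetric]) (smt (verit) a)
  then have "summable a"
    using a by (intro summableI_nonneg_bounded[of a C])
  then have a0: "a \<longlonglongrightarrow> 0"
    by (rule summable_LIMSEQ_zero)
  have "(\<lambda>k. \<omega> (a k)) \<longlonglongrightarrow> \<omega> 0"
    using continuous_on_tendsto_compose[OF cont a0] a by simp
  then show "\<theta> \<longlonglongrightarrow> 0"
    using le zero by (intro tendsto_sandwich[of "\<lambda>_. 0" \<theta> _ "\<lambda>k. \<omega> (a k)"]) auto
  have "\<exists>j\<le>k. a j \<le> C / (real k + 1)"
  proof (rule ccontr)
    assume *: "\<not> (\<exists>j\<le>k. a j \<le> C / (real k + 1))"
    then have "C / (real k + 1) < a j" if "j \<in> {..k}" for j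
      using * that by force
    \<comment> \<open>The set \<open>{..k}\<close> has \<open>k + 1\<close> elements, so the sum on
      the left is exactly \<open>C\<close>.\<close>
    then have "(\<Sum>j\<le>k. C / (real k + 1)) < sum a {..k}"
      by (intro sum_strict_mono) auto
    also have "\<dots> \<le> C" by (rule sum)
    finally show False by (simp add: field_simps)
  qed
  then obtain j where j: "j \<le> k" "a j \<le> C / (real k + 1)"
    by blast
  then show "\<exists>j\<le>k. \<theta> j \<le> \<omega> (C / (real k + 1))"
    using le(2)[of j] mono[OF a j(2)] by (auto intro: order_trans)
qed

theorem theorem3p3:
  fixes g :: "'m::finite \<Rightarrow> real ^ 'n \<Rightarrow> ereal"
    and h :: "'m \<Rightarrow> real ^ 'n \<Rightarrow> real"
    and \<nu> M\<^sub>\<nu> D \<Delta> :: real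
    and M :: "'m \<Rightarrow> real"
    and s :: "real ^ 'n \<Rightarrow> real ^ 'n"
    and x :: "nat \<Rightarrow> real ^ 'n"
  assumes g_proper: "\<And>i. proper_fun (g i)"
    and g_convex: "\<And>i. convex_fun (g i)"
    and g_lsc: "\<And>i. lsc_fun (g i)"
    and h_C1: "\<And>i. C1_fun (h i)"
    and domG_nonempty: "domG g \<noteq> {}"
    and domG_convex: "convex (domG g)"
    and domG_compact: "compact (domG g)"
    and nu: "0 < \<nu>" "\<nu> \<le> 1"
    and holder: "holder_grad g h \<nu> M"
    and minimizer: "gap_minimizer g h s"
    and M\<^sub>\<nu>: "M\<^sub>\<nu> = (MAX i. M i)"
    and sequence: "pgm_condg_sequence g h \<nu> M\<^sub>\<nu> s x"
    and D: "D = diameter (domG g)"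
    and \<Delta>: "\<Delta> = real_of_ereal (f_max g h (x 0) - f_inf g h)"
  shows "((\<lambda>k. gap_fun g h (x k)) \<longlonglongrightarrow> 0) \<and>
    (\<forall>k. (MIN j\<in>{..k}. \<bar>gap_fun g h (x j)\<bar>) \<le>
       ereal (max ((1 + \<nu>) * \<Delta> / (\<nu> * (real k + 1)))
                  (((1 + \<nu>) * M\<^sub>\<nu> powr (1 / \<nu>) * D powr ((1 + \<nu>) / \<nu>) * \<Delta> /
                    (\<nu> * (real k + 1))) powr (\<nu> / (1 + \<nu>)))))"
proof -
  \<comment> \<open>\<open>real_of_ereal\<close> sends infinite values to 0, so these real copies
    are faithful only where the originals are finite; on \<open>domG g\<close> this is
    \<open>objective_real\<close> for \<open>f\<close> and the fact \<open>gap\<close> for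
    \<open>\<theta>\<close>.\<close>
  define f where "f i z = real_of_ereal (g i z) + h i z" for i z
  define \<theta> where "\<theta> z = \<bar>real_of_ereal (gap_fun g h z)\<bar>" for z
  have \<theta>_nonneg: "0 \<le> \<theta> z" for z
    unfolding \<theta>_def by (rule abs_ge_zero)
  define t where "t z = pgm_step g h \<nu> M\<^sub>\<nu> s z" for z
  have M_le: "M i \<le> M\<^sub>\<nu>" for i
    by (simp add: M\<^sub>\<nu>)
  have M_pos: "0 < M\<^sub>\<nu>"
    using holder M_le by (metis holder_grad_def less_le_trans)
  have fin: "\<bar>g i z\<bar> \<noteq> \<infinity>" if "z \<in> domG g" for i z
    using that g_proper[of i] by (auto simp: domG_def edom_def proper_fun_def)
  have g_real: "g i z = ereal (real_of_ereal (g i z))" if "z \<in> domG g" for i z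
    using fin[OF that, of i] by (simp add: ereal_real')
  have objective_real: "objective g h i z = ereal (f i z)" if "z \<in> domG g" for i z
    using g_real[OF that, of i] by (simp add: objective_def f_def) (metis plus_ereal.simps(1))

  \<comment> \<open>The gap function on the domain: finiteness, sign and minimizer\<close>
  have gap: "s z \<in> domG g" "gap_fun g h z = ereal (- \<theta> z)"
      "\<And>i. real_of_ereal (g i (s z)) - real_of_ereal (g i z) + grad (h i) z \<bullet> (s z - z) \<le> - \<theta> z"
    if z: "z \<in> domG g" for z
  proof -
    show sz: "s z \<in> domG g"
      using minimizer z by (simp add: gap_minimizer_def)
    have "gap_model g h z (s z) \<le> gap_model g h z u" for u
      using minimizer z by (auto simp: gap_minimizer_def is_arg_min_def not_less)
    then have eq: "gap_fun g h z = gap_model g h z (s z)"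
      unfolding gap_fun_def by (intro antisym INF_lower INF_greatest) auto
    have model: "gap_model g h z u = (MAX i. ereal (real_of_ereal (g i u) - real_of_ereal (g i z) + grad (h i) z \<bullet> (u - z)))"
      if "u \<in> domG g" for u
      unfolding gap_model_def
      by (subst g_real[OF z], subst g_real[OF that]) simp
    \<comment> \<open>The competitor \<open>u = z\<close> makes every term of the model vanish. The
      gap is therefore nonpositive and equals minus its absolute value.\<close>
    have "gap_fun g h z \<le> gap_model g h z z"
      unfolding gap_fun_def by (intro INF_lower) auto
    also have "\<dots> = 0"
      using model[OF z] by (simp add: zero_ereal_def)
    finally have le0: "gap_fun g h z \<le> 0" .
    \<comment> \<open>A maximum over a finite index type is attained by one of its terms, all of
      which are real; this gives finiteness of the gap.\<close>
    have "gap_fun g h z \<in> range (\<lambda>i. ereal (real_of_ereal (g i (s z)) - real_of_ereal (g i z) + grad (h i) z \<bullet> (s z - z)))"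
      unfolding eq model[OF sz] by (rule Max_in) auto
    then obtain w where w: "gap_fun g h z = ereal w" by auto
    then show th: "gap_fun g h z = ereal (- \<theta> z)"
      using le0 by (simp add: \<theta>_def)
    fix i
    have "ereal (real_of_ereal (g i (s z)) - real_of_ereal (g i z) + grad (h i) z \<bullet> (s z - z)) \<le> gap_fun g h z"
      unfolding eq model[OF sz] by (rule Max_ge) auto
    then show "real_of_ereal (g i (s z)) - real_of_ereal (g i z) + grad (h i) z \<bullet> (s z - z) \<le> - \<theta> z"
      by (simp add: th)
  qed

  \<comment> \<open>One iteration: step size, feasibility and decrease of each objective\<close>
  have step: "0 < t z" "t z \<le> 1" "z + t z *\<^sub>R (s z - z) \<in> domG g"
      "\<And>i. f i (z + t z *\<^sub>R (s z - z)) \<le> f i z - \<nu> / (1 + \<nu>) * (t z * \<theta> z)"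
      "\<theta> z \<le> max (t z * \<theta> z)
        ((M\<^sub>\<nu> powr (1 / \<nu>) * D powr ((1 + \<nu>) / \<nu>) * (t z * \<theta> z)) powr (\<nu> / (1 + \<nu>)))"
    if z: "z \<in> domG g" and nz: "gap_fun g h z \<noteq> 0" for z
  proof -
    note gz = gap[OF z]
    have th: "0 < \<theta> z"
      using nz gz(2) \<theta>_nonneg[of z] by (cases "\<theta> z = 0") auto
    \<comment> \<open>Otherwise the model inequality at \<open>s z\<close> would read
      \<open>0 \<le> - \<theta> z\<close>.\<close>
    have "s z \<noteq> z"
      using gz(3) th by force
    then have d: "0 < norm (s z - z)" by simp
    have dD: "norm (s z - z) \<le> D"
      using diameter_bounded_bound[OF compact_imp_bounded[OF domG_compact] gz(1) z]
      by (simp add: D dist_norm)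
    have t_eq: "t z = min 1 ((\<theta> z / (M\<^sub>\<nu> * norm (s z - z) powr (1 + \<nu>))) powr (1 / \<nu>))"
      using th by (simp add: t_def pgm_step_def gz(2))
    note bounds = min_step_bounds[OF th M_pos d nu(1) dD, folded t_eq]
    show t: "0 < t z" "t z \<le> 1"
      and "\<theta> z \<le> max (t z * \<theta> z)
        ((M\<^sub>\<nu> powr (1 / \<nu>) * D powr ((1 + \<nu>) / \<nu>) * (t z * \<theta> z)) powr (\<nu> / (1 + \<nu>)))"
      using bounds by auto
    have comb: "z + t z *\<^sub>R (s z - z) = (1 - t z) *\<^sub>R z + t z *\<^sub>R s z"
      by (simp add: algebra_simps)
    show new: "z + t z *\<^sub>R (s z - z) \<in> domG g"
      unfolding comb using domG_convex z gz(1) t by (simp add: convexD_alt)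
    fix i
    let ?n = "z + t z *\<^sub>R (s z - z)"
    have "g i ?n \<le> ereal (1 - t z) * g i z + ereal (t z) * g i (s z)"
      unfolding comb using g_convex[of i] t by (simp add: convex_fun_def)
    then have g_le: "real_of_ereal (g i ?n) \<le>
        (1 - t z) * real_of_ereal (g i z) + t z * real_of_ereal (g i (s z))"
      by (subst (asm) (1) g_real[OF new], subst (asm) (1) g_real[OF z],
          subst (asm) (1) g_real[OF gz(1)]) simp
    \<comment> \<open>The set \<open>domG g\<close> lies in every \<open>edom (g i)\<close>, so all
      Hoelder conditions hold there with the common constant \<open>M\<^sub>\<nu>\<close>, and by
      convexity it contains the segment used by \<open>holder_descent\<close>.\<close>
    have "norm (grad (h i) y - grad (h i) z) \<le> M\<^sub>\<nu> * norm (y - z) powr \<nu>" if "y \<in> domG g" for y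
    proof -
      have "norm (grad (h i) y - grad (h i) z) \<le> M i * norm (y - z) powr \<nu>"
        using holder that z by (auto simp: holder_grad_def domG_def)
      also have "\<dots> \<le> M\<^sub>\<nu> * norm (y - z) powr \<nu>"
        by (intro mult_right_mono M_le) auto
      finally show ?thesis .
    qed
    then have "h i ?n \<le> h i z + t z * (grad (h i) z \<bullet> (s z - z))
        + M\<^sub>\<nu> * (t z * norm (s z - z)) powr (1 + \<nu>) / (1 + \<nu>)"
      using h_C1[of i] t by (intro holder_descent[OF _ domG_convex z gz(1) _ nu(1)])
        (auto simp: C1_fun_def)
    also have "\<dots> \<le> h i z + t z * (grad (h i) z \<bullet> (s z - z)) + t z * \<theta> z / (1 + \<nu>)"
      using bounds(3) nu by (simp add: divide_right_mono)
    finally have "f i ?n \<le> f i z + t z * (real_of_ereal (g i (s z)) - real_of_ereal (g i z)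
        + grad (h i) z \<bullet> (s z - z)) + t z * \<theta> z / (1 + \<nu>)"
      using g_le by (simp add: f_def algebra_simps)
    \<comment> \<open>The linear model gains \<open>t z * \<theta> z\<close> and the Hoelder error
      returns at most the fraction \<open>1 / (1 + \<nu>)\<close> of it, leaving
      \<open>\<nu> / (1 + \<nu>)\<close>.\<close>
    also have "\<dots> \<le> f i z + t z * (- \<theta> z) + t z * \<theta> z / (1 + \<nu>)"
      using mult_left_mono[OF gz(3)[of i], of "t z"] t(1) by simp
    also have "\<dots> = f i z - \<nu> / (1 + \<nu>) * (t z * \<theta> z)"
      using nu by (simp add: field_simps)
    finally show "f i ?n \<le> f i z - \<nu> / (1 + \<nu>) * (t z * \<theta> z)" .
  qed

  \<comment> \<open>The iterates: feasibility and accumulated decrease\<close>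
  have nz: "gap_fun g h (x k) \<noteq> 0"
    and x_Suc: "x (Suc k) = x k + t (x k) *\<^sub>R (s (x k) - x k)" for k
    using sequence by (auto simp: pgm_condg_sequence_def t_def)
  have x_dom: "x k \<in> domG g" for k
  proof (induction k)
    case 0
    then show ?case using sequence by (simp add: pgm_condg_sequence_def)
  next
    case (Suc k)
    then show ?case using step(3)[OF Suc nz] by (simp add: x_Suc)
  qed
  define a where "a k = t (x k) * \<theta> (x k)" for k
  have a_nonneg: "0 \<le> a k" for k
    using step(1)[OF x_dom nz] by (simp add: a_def \<theta>_nonneg less_imp_le)

  \<comment> \<open>Reaching \<open>x (Suc k)\<close> takes \<open>k + 1\<close> steps, whose
    decreases are indexed by \<open>{..k}\<close>.\<close>
  have telescope: "f i (x (Suc k)) \<le> f i (x 0) - \<nu> / (1 + \<nu>) * sum a {..k}" for i k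
  proof (induction k)
    case 0
    then show ?case using step(4)[OF x_dom nz, of i 0] by (simp add: x_Suc a_def)
  next
    case (Suc k)
    have "f i (x (Suc (Suc k))) \<le> f i (x (Suc k)) - \<nu> / (1 + \<nu>) * a (Suc k)"
      using step(4)[OF x_dom nz, of i "Suc k"] by (simp only: x_Suc[of "Suc k"] a_def)
    then show ?case using Suc by (simp add: distrib_left)
  qed

  \<comment> \<open>Finiteness of the extreme objective values\<close>
  have "\<exists>b. \<forall>z\<in>domG g. b \<le> f i z" for i
  proof -
    obtain b where b: "\<And>z. z \<in> domG g \<Longrightarrow> ereal b \<le> g i z"
      using lsc_fun_bounded_below[OF g_lsc domG_compact, of i] g_proper[of i]
      unfolding proper_fun_def by blast
    have "continuous_on (domG g) (h i)"
      using h_C1[of i] by (auto simp: C1_fun_def intro!: continuous_at_imp_continuous_on differentiable_imp_continuous_within)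
    then obtain y where y: "\<And>z. z \<in> domG g \<Longrightarrow> h i y \<le> h i z"
      using continuous_attains_inf[OF domG_compact domG_nonempty] by metis
    have "b + h i y \<le> f i z" if "z \<in> domG g" for z
      using b[OF that] y[OF that] g_real[OF that, of i] by (metis add_mono ereal_less_eq(3) f_def)
    then show ?thesis by blast
  qed
  then obtain b where b: "\<And>i z. z \<in> domG g \<Longrightarrow> b i \<le> f i z"
    by metis
  have f_inf_le: "f_inf g h \<le> ereal (f i z)" if "z \<in> domG g" for i z
  proof -
    have "f_inf g h \<le> (INF z\<in>domG g. objective g h i z)"
      unfolding f_inf_def by (rule Min_le) auto
    also have "\<dots> \<le> objective g h i z"
      using that by (rule INF_lower)
    finally show ?thesis using objective_real[OF that] by simp
  qed
  have "f_inf g h \<in> range (\<lambda>i. INF z\<in>domG g. objective g h i z)"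
    unfolding f_inf_def by (rule Min_in) auto
  then obtain i where i: "f_inf g h = (INF z\<in>domG g. objective g h i z)" by blast
  have "ereal (b i) \<le> f_inf g h"
    unfolding i using b by (intro INF_greatest) (simp add: objective_real)
  with f_inf_le[OF x_dom[of 0], of i] obtain m where m: "f_inf g h = ereal m"
    by (cases "f_inf g h") auto
  have fm: "f_max g h (x 0) = (MAX i. ereal (f i (x 0)))"
    by (simp add: f_max_def objective_real[OF x_dom])
  have "f_max g h (x 0) \<in> range (\<lambda>i. ereal (f i (x 0)))"
    unfolding fm by (rule Max_in) auto
  \<comment> \<open>The index \<open>i0\<close> attains the maximum at \<open>x 0\<close>. As
    \<open>m\<close> bounds every objective from below, telescoping along \<open>f i0\<close> alone
    yields the total decrease \<open>\<Delta>\<close>.\<close>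
  then obtain i0 where i0: "f_max g h (x 0) = ereal (f i0 (x 0))" by blast
  have \<Delta>_eq: "\<Delta> = f i0 (x 0) - m"
    by (simp add: \<Delta> m i0)

  \<comment> \<open>Summability and the convergence rate\<close>
  define C where "C = (1 + \<nu>) * \<Delta> / \<nu>"
  have sum_le: "sum a {..k} \<le> C" for k
  proof -
    have "m \<le> f i0 (x (Suc k))"
      using f_inf_le[OF x_dom, of i0 "Suc k"] m by simp
    also have "\<dots> \<le> f i0 (x 0) - \<nu> / (1 + \<nu>) * sum a {..k}"
      by (rule telescope)
    finally have "\<nu> / (1 + \<nu>) * sum a {..k} \<le> \<Delta>"
      by (simp add: \<Delta>_eq)
    then show ?thesis
      using nu by (simp add: C_def field_simps)
  qed

  define A where "A = M\<^sub>\<nu> powr (1 / \<nu>) * D powr ((1 + \<nu>) / \<nu>)"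
  \<comment> \<open>The two arguments of the maximum are the full-step and short-step cases; at
    \<open>C / (k + 1)\<close> the value is the bound of the theorem.\<close>
  define \<omega> where "\<omega> u = max u ((A * u) powr (\<nu> / (1 + \<nu>)))" for u
  have A: "0 \<le> A" by (simp add: A_def)
  have \<omega>_mono: "\<omega> u \<le> \<omega> v" if "0 \<le> u" "u \<le> v" for u v
    unfolding \<omega>_def using that A nu by (intro max.mono powr_mono2 mult_left_mono) auto
  have \<omega>_cont: "continuous_on {0..} \<omega>"
    unfolding \<omega>_def using A nu
    by (intro continuous_on_max continuous_on_powr' continuous_on_mult continuous_on_id
        continuous_on_const) auto
  have \<theta>_le: "\<theta> (x k) \<le> \<omega> (a k)" for k
    using step(5)[OF x_dom nz] by (simp add: \<omega>_def A_def a_def)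
  have \<omega>_zero: "\<omega> 0 = 0"
    using nu by (simp add: \<omega>_def)
  note rate = bounded_sums_imp_rate[where \<theta>="\<lambda>k. \<theta> (x k)",
      OF a_nonneg sum_le \<theta>_nonneg \<theta>_le \<omega>_mono \<omega>_cont \<omega>_zero]

  show ?thesis
  proof (intro conjI allI)
    \<comment> \<open>The limit is taken over the reals and transported through
      \<open>gap_fun g h (x k) = ereal (- \<theta> (x k))\<close>.\<close>
    have "(\<lambda>k. ereal (- \<theta> (x k))) \<longlonglongrightarrow> ereal (- 0)"
      by (intro tendsto_intros rate(1))
    then show "(\<lambda>k. gap_fun g h (x k)) \<longlonglongrightarrow> 0"
      unfolding gap(2)[OF x_dom] zero_ereal_def by (simp only: minus_zero)
  next
    fix k
    obtain j where j: "j \<le> k" "\<theta> (x j) \<le> \<omega> (C / (real k + 1))"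
      using rate(2) by blast
    have "(MIN j\<in>{..k}. \<bar>gap_fun g h (x j)\<bar>) \<le> \<bar>gap_fun g h (x j)\<bar>"
      using j(1) by (intro Min_le) auto
    also have "\<dots> = ereal (\<theta> (x j))"
      by (simp add: gap(2)[OF x_dom] \<theta>_nonneg)
    also have "\<dots> \<le> ereal (\<omega> (C / (real k + 1)))"
      using j(2) by simp
    finally show "(MIN j\<in>{..k}. \<bar>gap_fun g h (x j)\<bar>) \<le>
       ereal (max ((1 + \<nu>) * \<Delta> / (\<nu> * (real k + 1)))
                  (((1 + \<nu>) * M\<^sub>\<nu> powr (1 / \<nu>) * D powr ((1 + \<nu>) / \<nu>) * \<Delta> /
                    (\<nu> * (real k + 1))) powr (\<nu> / (1 + \<nu>))))"
      by (simp add: \<omega>_def C_def A_def mult_ac)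
  qed
qed

end
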